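(* Let $M$ be a connected matroid, let $N$ be a binary matroid which is not a circuit (i.e., $E(N) \notin \mathcal{C}(N)$), and let $f: M \rightarrow N$ be a matroid homomorphism. Then there exist a matroid $H$, a matroid homeomorphism $g: M \rightarrow H$ and a circuit injection $h: H \rightarrow N$ such that $f = h \circ g$ (as maps of ground sets); moreover $M$ is isomorphic to a subdivision of $H = g(M)$.
   Context: For a matroid $X$, $E(X)$ denotes its ground set and $\mathcal{C}(X)$ its set of circuits. A matroid homomorphism $f: M \rightarrow N$ is a map $f: E(M) \rightarrow E(N)$ from the ground set of $M$ onto the ground set of $N$ such that $f(C) \in \mathcal{C}(N)$ for every $C \in \mathcal{C}(M)$. A homomorphism is a homeomorphism if in addition $f^{-1}(D) \in \mathcal{C}(M)$ for every $D \in \mathcal{C}(N)$. A circuit injection is a homomorphism whose underlying map of ground sets is one-to-one. A matroid $M'$ is a series extension of a matroid $H'$ at an element $e \in E(H')$ by a new element $e'$ if $E(M') = E(H') \cup \{e'\}$ and $\mathcal{C}(M') = \{C : C \in \mathcal{C}(H'), e \notin C\} \cup \{C \cup \{e'\} : C \in \mathcal{C}(H'), e \in C\}$; a subdivision of $H'$ is any matroid obtained from $H'$ by a finite sequence (possibly empty) of series extensions. *)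

theory Defs
  imports Main "HOL-Library.Z2"
begin

record 'a set_system =
  ground :: "'a set"
  circuits :: "'a set set"

text \<open>Finite matroids, axiomatised by their circuits.\<close>

locale matroid =
  fixes M :: "'a set_system"
  assumes finite_ground: "finite (ground M)"
    and circuits_subset: "C \<in> circuits M \<Longrightarrow> C \<subseteq> ground M"
    and empty_not_circuit: "{} \<notin> circuits M"
    and circuits_antichain:
      "C \<in> circuits M \<Longrightarrow> D \<in> circuits M \<Longrightarrow> C \<subseteq> D \<Longrightarrow> C = D"
    and circuit_elimination:
      "C \<in> circuits M \<Longrightarrow> D \<in> circuits M \<Longrightarrow> C \<noteq> D \<Longrightarrow> e \<in> C \<inter> D \<Longrightarrow>
        \<exists>B \<in> circuits M. B \<subseteq> (C \<union> D) - {e}"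

definition indep :: "'a set_system \<Rightarrow> 'a set \<Rightarrow> bool" where
  "indep M X \<longleftrightarrow> X \<subseteq> ground M \<and> (\<forall>C \<in> circuits M. \<not> C \<subseteq> X)"

definition connected_matroid :: "'a set_system \<Rightarrow> bool" where
  "connected_matroid M \<longleftrightarrow>
    (\<forall>x \<in> ground M. \<forall>y \<in> ground M. x \<noteq> y \<longrightarrow> (\<exists>C \<in> circuits M. x \<in> C \<and> y \<in> C))"

text \<open>\<open>A\<close> is a matrix with \<open>n\<close> rows and columns labelled by the ground set. Independence refers to
  the labelled family of columns, so equal columns with distinct labels are dependent.\<close>

definition represents :: "nat \<Rightarrow> (nat \<Rightarrow> 'a \<Rightarrow> 'k::field) \<Rightarrow> 'a set_system \<Rightarrow> bool" where
  "represents n A M \<longleftrightarrow>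
    (\<forall>X \<subseteq> ground M. indep M X \<longleftrightarrow>
      (\<forall>c. (\<forall>i<n. (\<Sum>x\<in>X. c x * A i x) = 0) \<longrightarrow> (\<forall>x\<in>X. c x = 0)))"

definition binary_matroid :: "'a set_system \<Rightarrow> bool" where
  "binary_matroid M \<longleftrightarrow> (\<exists>n (A :: nat \<Rightarrow> 'a \<Rightarrow> bit). represents n A M)"

definition matroid_hom :: "'a set_system \<Rightarrow> 'b set_system \<Rightarrow> ('a \<Rightarrow> 'b) \<Rightarrow> bool" where
  "matroid_hom M N f \<longleftrightarrow>
    f ` ground M = ground N \<and> (\<forall>C \<in> circuits M. f ` C \<in> circuits N)"

definition matroid_homeo :: "'a set_system \<Rightarrow> 'b set_system \<Rightarrow> ('a \<Rightarrow> 'b) \<Rightarrow> bool" where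
  "matroid_homeo M N f \<longleftrightarrow>
    matroid_hom M N f \<and> (\<forall>D \<in> circuits N. f -` D \<inter> ground M \<in> circuits M)"

definition circuit_injection :: "'a set_system \<Rightarrow> 'b set_system \<Rightarrow> ('a \<Rightarrow> 'b) \<Rightarrow> bool" where
  "circuit_injection M N f \<longleftrightarrow> matroid_hom M N f \<and> inj_on f (ground M)"

definition image_system :: "('a \<Rightarrow> 'b) \<Rightarrow> 'a set_system \<Rightarrow> 'b set_system" where
  "image_system f M = \<lparr>ground = f ` ground M, circuits = (\<lambda>C. f ` C) ` circuits M\<rparr>"

definition isomorphic_matroids :: "'a set_system \<Rightarrow> 'b set_system \<Rightarrow> bool" where
  "isomorphic_matroids M N \<longleftrightarrow>
    (\<exists>\<phi>. bij_betw \<phi> (ground M) (ground N) \<and>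
      (\<forall>C \<subseteq> ground M. C \<in> circuits M \<longleftrightarrow> \<phi> ` C \<in> circuits N))"

definition series_extension :: "'a set_system \<Rightarrow> 'a \<Rightarrow> 'a \<Rightarrow> 'a set_system \<Rightarrow> bool" where
  "series_extension H e e' M \<longleftrightarrow>
    matroid H \<and> matroid M \<and> e \<in> ground H \<and> e' \<notin> ground H \<and>
    ground M = ground H \<union> {e'} \<and>
    circuits M = {C. C \<in> circuits H \<and> e \<notin> C} \<union> {C \<union> {e'} | C. C \<in> circuits H \<and> e \<in> C}"

inductive subdivision :: "'a set_system \<Rightarrow> 'a set_system \<Rightarrow> bool" for H where
  refl: "matroid H \<Longrightarrow> subdivision H H"
| step: "subdivision H K \<Longrightarrow> series_extension K e e' M \<Longrightarrow> subdivision H M"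

text \<open>The type of \<open>H\<close> may have too few elements outside the ground set of \<open>H\<close> to serve as the new
  elements of series extensions, so subdivisions are formed on a copy of \<open>H\<close> inside a larger type.\<close>

definition isomorphic_to_subdivision :: "'a set_system \<Rightarrow> 'b set_system \<Rightarrow> bool" where
  "isomorphic_to_subdivision M H \<longleftrightarrow>
    (\<exists>S :: ('b + nat) set_system. subdivision (image_system Inl H) S \<and> isomorphic_matroids M S)"

end

theory Submission
  imports Defs
begin

text \<open>
  Take \<open>H = f(M)\<close>. Everything follows once each circuit \<open>C\<close> of \<open>M\<close> is shown to be a union of fibres
  of \<open>f\<close>: the fibres are then series classes. Suppose some \<open>y \<notin> C\<close> has \<open>f y \<in> f(C) = F\<close>. Attaching to
  \<open>C\<close> a minimal ear through \<open>y\<close> gives a connected restriction of nullity 2 on a set \<open>E'\<close>, and since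
  symmetric differences of distinct circuits of the binary matroid \<open>N\<close> contain circuits,
  \<open>f(E') = F\<close>. If \<open>F\<close> were not all of \<open>E(N)\<close>, attach to \<open>E'\<close> a minimal ear \<open>S\<close> containing an
  element mapped outside \<open>F\<close>. Two distinct circuits of \<open>E'\<close> meet this ear, each is split by \<open>S\<close> into two
  parts whose images partition \<open>F\<close>, and binarity forces the same partition for both. Circuit
  elimination on \<open>S\<close> then shows that the two circuits coincide. Hence \<open>F = E(N)\<close> is a circuit.
\<close>

section \<open>Ears\<close>

context matroid
begin

lemma finite_circuit: "C \<in> circuits M \<Longrightarrow> finite C"
  using circuits_subset finite_ground finite_subset by blast

text \<open>If weak elimination of \<open>e\<close> gives a circuit \<open>B\<close> that loses
  \<open>x\<close>, then \<open>B\<close> contains some \<open>z\<close> in \<open>D - C\<close>.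
  Eliminating \<open>z\<close> from \<open>D\<close> and \<open>B\<close> while keeping
  \<open>e\<close>, and then \<open>e\<close> from \<open>C\<close> and the result while keeping
  \<open>x\<close>, falls under the induction: the first union lacks \<open>x\<close>, the second
  lacks \<open>z\<close>.\<close>

lemma strong_circuit_elimination:
  assumes "C \<in> circuits M" "D \<in> circuits M" "e \<in> C \<inter> D" "x \<in> C - D"
  shows "\<exists>B \<in> circuits M. x \<in> B \<and> B \<subseteq> C \<union> D - {e}"
  using assms
proof (induction "card (C \<union> D)" arbitrary: C D e x rule: less_induct)
  case less
  have fin: "finite (C \<union> D)"
    using less.prems finite_circuit by blast
  obtain B where B: "B \<in> circuits M" "B \<subseteq> C \<union> D - {e}"
    using circuit_elimination[of C D e] less.prems by blast
  show ?case
  proof (cases "x \<in> B")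
    case True
    then show ?thesis using B by blast
  next
    case xB: False
    have "\<not> B \<subseteq> C"
      using circuits_antichain[of B C] B less.prems by blast
    then obtain z where z: "z \<in> B" "z \<in> D" "z \<notin> C" using B by blast
    have "D \<union> B \<subset> C \<union> D" using B xB less.prems by blast
    then have "card (D \<union> B) < card (C \<union> D)" by (rule psubset_card_mono[OF fin])
    moreover have "e \<in> D - B" using B less.prems by blast
    ultimately obtain D' where D': "D' \<in> circuits M" "e \<in> D'" "D' \<subseteq> D \<union> B - {z}"
      using less.hyps[of D B z e] less.prems(2) B(1) z by blast
    have "C \<union> D' \<subset> C \<union> D" using D' B z by blast
    then have "card (C \<union> D') < card (C \<union> D)" by (rule psubset_card_mono[OF fin])
    moreover have "x \<in> C - D'" using D' xB less.prems by blast
    ultimately obtain B' where "B' \<in> circuits M" "x \<in> B'" "B' \<subseteq> C \<union> D' - {e}"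
      using less.hyps[of C D' e x] less.prems D' by blast
    then show ?thesis using D' B by blast
  qed
qed

text \<open>Choosing \<open>D'\<close> with as few elements outside \<open>X\<close> as possible
  makes \<open>D' - X\<close> behave like a series class over \<open>X\<close>.\<close>

lemma minimal_ear:
  assumes D: "D \<in> circuits M" "y \<in> D" "y \<notin> X" "D \<inter> X \<noteq> {}" "D \<subseteq> U" and "X \<subseteq> U"
  obtains D' where "D' \<in> circuits M" "y \<in> D'" "D' \<inter> X \<noteq> {}" "D' \<subseteq> U"
    "\<And>B. B \<in> circuits M \<Longrightarrow> B \<subseteq> X \<union> D' \<Longrightarrow> B \<subseteq> X \<or> D' - X \<subseteq> B"
proof -
  let ?P = "\<lambda>D. D \<in> circuits M \<and> y \<in> D \<and> D \<inter> X \<noteq> {} \<and> D \<subseteq> U"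
  obtain D' where P: "?P D'" and min: "\<And>B. ?P B \<Longrightarrow> card (D' - X) \<le> card (B - X)"
    using ex_has_least_nat[of ?P D "\<lambda>D. card (D - X)"] D by blast
  \<comment> \<open>Such a \<open>B\<close> is smaller outside \<open>X\<close>, so by minimality it
    misses \<open>X\<close>. Then it lies in \<open>D'\<close> and equals \<open>D'\<close>,
    although it lacks \<open>t\<close>.\<close>
  have no: "False" if "B \<in> circuits M" "y \<in> B" "B \<subseteq> X \<union> D'" "t \<in> D' - X" "t \<notin> B" for B t
  proof -
    have "B - X \<subset> D' - X" using that by blast
    then have "card (B - X) < card (D' - X)"
      using psubset_card_mono[of "D' - X" "B - X"] finite_circuit P by blast
    then have "\<not> ?P B" using min by fastforce
    then have "B \<inter> X = {}" using that P \<open>X \<subseteq> U\<close> by blast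
    then have "B \<subseteq> D'" using that by blast
    then have "B = D'" using circuits_antichain P that by blast
    then show False using that by blast
  qed
  have "B \<subseteq> X \<or> D' - X \<subseteq> B" if B: "B \<in> circuits M" "B \<subseteq> X \<union> D'" for B
  proof (rule ccontr)
    assume "\<not> ?thesis"
    then obtain s t where st: "s \<in> B" "s \<notin> X" "t \<in> D' - X" "t \<notin> B" by blast
    then have "y \<notin> B" using no B by blast
    \<comment> \<open>Elimination that keeps \<open>y\<close> turns a partial use of the ear
      avoiding \<open>y\<close> into one through \<open>y\<close>, which was just excluded.\<close>
    then obtain G where "G \<in> circuits M" "y \<in> G" "G \<subseteq> D' \<union> B - {s}"
      using strong_circuit_elimination[of D' B s y] P B st by blast
    then show False using no[of G s] st B by blast
  qed
  then show thesis using that P by blast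
qed

text \<open>\<open>C \<union> D\<close> is then a connected restriction of nullity 2, having \<open>D - C\<close> as a series class.\<close>

definition is_ear :: "'a set \<Rightarrow> 'a set \<Rightarrow> bool" where
  "is_ear C D \<longleftrightarrow> C \<in> circuits M \<and> D \<in> circuits M \<and> C \<inter> D \<noteq> {} \<and> D \<noteq> C \<and>
    (\<forall>B \<in> circuits M. B \<subseteq> C \<union> D \<longrightarrow> B = C \<or> D - C \<subseteq> B)"

lemma ear_exists:
  assumes "C \<in> circuits M" "D \<in> circuits M" "y \<in> D" "y \<notin> C" "C \<inter> D \<noteq> {}" "C \<union> D \<subseteq> U"
  obtains D' where "is_ear C D'" "y \<in> D'" "D' \<subseteq> U"
proof -
  obtain D' where D': "D' \<in> circuits M" "y \<in> D'" "D' \<inter> C \<noteq> {}" "D' \<subseteq> U"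
    "\<And>B. B \<in> circuits M \<Longrightarrow> B \<subseteq> C \<union> D' \<Longrightarrow> B \<subseteq> C \<or> D' - C \<subseteq> B"
    using minimal_ear[of D y C U] assms by blast
  have "B = C \<or> D' - C \<subseteq> B" if "B \<in> circuits M" "B \<subseteq> C \<union> D'" for B
    using D'(5)[OF that] circuits_antichain[OF that(1) assms(1)] by metis
  moreover have "C \<inter> D' \<noteq> {}" "D' \<noteq> C" using D'(2,3) assms(4) by auto
  ultimately have "is_ear C D'"
    unfolding is_ear_def using assms(1) D'(1) by simp
  then show thesis using that D' by blast
qed

text \<open>Two circuits other than \<open>C\<close> share all of \<open>D - C\<close>. Eliminating
  an element of it leaves room only for \<open>C\<close>, which therefore lies in their
  union.\<close>

lemma ear_circuits_Un:
  assumes E: "is_ear C D" and B: "B \<in> circuits M" "B' \<in> circuits M" "B \<noteq> B'"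
    and sub: "B \<subseteq> C \<union> D" "B' \<subseteq> C \<union> D"
  shows "B \<union> B' = C \<union> D"
proof -
  have S: "G = C \<or> D - C \<subseteq> G" if "G \<in> circuits M" "G \<subseteq> C \<union> D" for G
    using E that unfolding is_ear_def by blast
  obtain s where s: "s \<in> D" "s \<notin> C"
    using E circuits_antichain[of D C] unfolding is_ear_def by blast
  show ?thesis
  proof (cases "B = C \<or> B' = C")
    case True
    then show ?thesis using S B sub by blast
  next
    case False
    then have DC: "D - C \<subseteq> B" "D - C \<subseteq> B'" using S B sub by blast+
    then obtain G where G: "G \<in> circuits M" "G \<subseteq> B \<union> B' - {s}"
      using circuit_elimination[of B B' s] B s by blast
    then have "G = C" using S sub s by blast
    then show ?thesis using G DC sub by blast
  qed
qed

text \<open>One circuit is \<open>D\<close>, the other comes from eliminating a common element of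
  \<open>C\<close> and \<open>D\<close>.\<close>

lemma ear_two_circuits:
  assumes E: "is_ear C D"
  obtains B B' where "B \<in> circuits M" "B' \<in> circuits M" "B \<noteq> B'" "B \<noteq> C" "B' \<noteq> C"
    "B \<subseteq> C \<union> D" "B' \<subseteq> C \<union> D" "D - C \<subseteq> B" "D - C \<subseteq> B'"
proof -
  have CD: "C \<in> circuits M" "D \<in> circuits M" "C \<inter> D \<noteq> {}" "D \<noteq> C"
    using E unfolding is_ear_def by auto
  then obtain e where e: "e \<in> C" "e \<in> D" by blast
  then obtain B where B: "B \<in> circuits M" "B \<subseteq> C \<union> D - {e}"
    using circuit_elimination[of C D e] CD by blast
  moreover have "D - C \<subseteq> B" using E B e unfolding is_ear_def by blast
  ultimately show thesis using that[of D B] CD e by blast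
qed

text \<open>Any two of three distinct circuits cover \<open>C \<union> D\<close>, so at most one of
  the three misses \<open>z\<close>.\<close>

lemma ear_two_circuits_through:
  assumes E: "is_ear C D" and z: "z \<in> C \<union> D"
  obtains B B' where "B \<in> circuits M" "B' \<in> circuits M" "B \<noteq> B'"
    "B \<subseteq> C \<union> D" "B' \<subseteq> C \<union> D" "z \<in> B" "z \<in> B'"
proof -
  obtain B B' where B: "B \<in> circuits M" "B' \<in> circuits M" "B \<noteq> B'" "B \<noteq> C" "B' \<noteq> C"
    "B \<subseteq> C \<union> D" "B' \<subseteq> C \<union> D"
    using ear_two_circuits[OF E] by metis
  have C: "C \<in> circuits M" "C \<subseteq> C \<union> D" using E unfolding is_ear_def by auto
  have "B \<union> B' = C \<union> D" "B \<union> C = C \<union> D" "B' \<union> C = C \<union> D"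
    using ear_circuits_Un[OF E] B C by blast+
  then consider "z \<in> B" "z \<in> B'" | "z \<in> B" "z \<in> C" | "z \<in> B'" "z \<in> C" using z by blast
  then show thesis using that B C by cases metis+
qed

end

section \<open>Binary matroids\<close>

text \<open>The support of a nontrivial relation among the columns of \<open>C\<close> is dependent,
  so it is all of \<open>C\<close> by the antichain property; over two elements every nonzero
  coefficient is 1.\<close>

lemma (in matroid) representing_circuit_sum:
  fixes A :: "nat \<Rightarrow> 'a \<Rightarrow> bit"
  assumes rep: "represents n A M" and C: "C \<in> circuits M" and i: "i < n"
  shows "(\<Sum>x\<in>C. A i x) = 0"
proof -
  have fin: "finite C" using finite_circuit C .
  have "\<not> indep M C" using C unfolding indep_def by blast
  then obtain c x where c: "\<forall>i<n. (\<Sum>x\<in>C. c x * A i x) = 0" and x: "x \<in> C" "c x \<noteq> 0"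
    using rep circuits_subset[OF C] unfolding represents_def by blast
  let ?S = "{x \<in> C. c x \<noteq> 0}"
  have "(\<Sum>x\<in>?S. c x * A i x) = 0" if "i < n" for i
  proof -
    have "(\<Sum>x\<in>?S. c x * A i x) = (\<Sum>x\<in>C. c x * A i x)"
      by (rule sum.mono_neutral_left) (use fin in auto)
    then show ?thesis using c that by simp
  qed
  moreover have "?S \<subseteq> ground M" using circuits_subset[OF C] by blast
  ultimately have "\<not> indep M ?S"
    using rep x unfolding represents_def by blast
  then obtain B where "B \<in> circuits M" "B \<subseteq> ?S"
    using \<open>?S \<subseteq> ground M\<close> unfolding indep_def by blast
  then have "?S = C" using circuits_antichain[of B C] C by blast
  then have "c x = 1" if "x \<in> C" for x using that by auto
  then have "(\<Sum>x\<in>C. A i x) = (\<Sum>x\<in>C. c x * A i x)" by (intro sum.cong) auto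
  then show ?thesis using c i by simp
qed

text \<open>Adding the column sums of \<open>C\<close> and \<open>D\<close> cancels
  \<open>C \<inter> D\<close> in characteristic 2, so the all-ones coefficients give a relation on
  the symmetric difference.\<close>

lemma (in matroid) binary_circuit_sym_diff:
  assumes "binary_matroid M" and C: "C \<in> circuits M" and D: "D \<in> circuits M" and "C \<noteq> D"
  obtains B where "B \<in> circuits M" "B \<subseteq> (C - D) \<union> (D - C)"
proof -
  obtain n and A :: "nat \<Rightarrow> 'a \<Rightarrow> bit" where rep: "represents n A M"
    using assms unfolding binary_matroid_def by blast
  let ?S = "(C - D) \<union> (D - C)"
  have fin: "finite C" "finite D" using finite_circuit C D by auto
  have zero: "(\<Sum>x\<in>?S. 1 * A i x) = 0" if "i < n" for i
  proof -
    have "(\<Sum>x\<in>?S. A i x) = (\<Sum>x\<in>C - D. A i x) + (\<Sum>x\<in>D - C. A i x)"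
      by (rule sum.union_disjoint) (use fin in auto)
    moreover have "(\<Sum>x\<in>C. A i x) = (\<Sum>x\<in>C - D. A i x) + (\<Sum>x\<in>C \<inter> D. A i x)"
      using fin by (metis add.commute sum.Int_Diff)
    moreover have "(\<Sum>x\<in>D. A i x) = (\<Sum>x\<in>D - C. A i x) + (\<Sum>x\<in>C \<inter> D. A i x)"
      using fin by (metis add.commute sum.Int_Diff inf_commute)
    ultimately have "(\<Sum>x\<in>?S. A i x) = 0"
      using representing_circuit_sum[OF rep C that] representing_circuit_sum[OF rep D that]
      by (cases "\<Sum>x\<in>C \<inter> D. A i x") auto
    then show ?thesis by (simp only: mult_1)
  qed
  have "?S \<subseteq> ground M" using circuits_subset C D by blast
  have "\<not> indep M ?S"
  proof
    assume "indep M ?S"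
    then have "\<forall>c. (\<forall>i<n. (\<Sum>x\<in>?S. c x * A i x) = 0) \<longrightarrow> (\<forall>x\<in>?S. c x = 0)"
      using rep \<open>?S \<subseteq> ground M\<close> unfolding represents_def by blast
    note indep = this[rule_format, of "\<lambda>_. 1"]
    obtain x where "x \<in> ?S" using \<open>C \<noteq> D\<close> by blast
    from indep[OF zero this] show False by simp
  qed
  then show thesis
    using that \<open>?S \<subseteq> ground M\<close> unfolding indep_def by blast
qed

section \<open>Circuits are unions of fibres\<close>

locale binary_matroid_hom = M: matroid M + N: matroid N
  for M :: "'a set_system" and N :: "'b set_system" +
  fixes f :: "'a \<Rightarrow> 'b"
  assumes binary: "binary_matroid N"
    and hom: "matroid_hom M N f"
begin

lemma circuit_through:
  assumes "connected_matroid M" "C \<in> circuits M" "x \<in> C" "y \<in> ground M" "y \<notin> C"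
  obtains K where "K \<in> circuits M" "x \<in> K" "y \<in> K"
proof -
  have "x \<in> ground M" "x \<noteq> y" using assms M.circuits_subset by blast+
  then show thesis using assms(1,4) that unfolding connected_matroid_def by metis
qed

lemma image_circuit: "C \<in> circuits M \<Longrightarrow> f ` C \<in> circuits N"
  using hom unfolding matroid_hom_def by blast

lemma sym_diff_subset_circuit:
  assumes "C \<in> circuits N" "D \<in> circuits N" "F \<in> circuits N" "(C - D) \<union> (D - C) \<subseteq> F" "C \<noteq> D"
  shows "(C - D) \<union> (D - C) = F"
  using N.binary_circuit_sym_diff[OF binary assms(1,2,5)] N.circuits_antichain assms(3,4)
  by (metis subset_antisym subset_trans)

text \<open>Two circuits containing the ear differ only inside \<open>C\<close>, so if their images
  differed, the symmetric difference of these would be the whole image of \<open>C\<close>. But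
  \<open>f y\<close> lies in both images. Hence the images agree, contain the image of
  \<open>C\<close>, and equal it.\<close>

lemma ear_image_subset:
  assumes E: "M.is_ear C D" and y: "y \<in> D - C" "f y \<in> f ` C"
  shows "f ` D \<subseteq> f ` C"
proof -
  obtain B B' where B: "B \<in> circuits M" "B' \<in> circuits M" "B \<noteq> B'"
    "B \<subseteq> C \<union> D" "B' \<subseteq> C \<union> D" "D - C \<subseteq> B" "D - C \<subseteq> B'"
    using M.ear_two_circuits[OF E] by metis
  have C: "f ` C \<in> circuits N" using E image_circuit unfolding M.is_ear_def by blast
  let ?S = "(f ` B - f ` B') \<union> (f ` B' - f ` B)"
  have "?S \<subseteq> f ` C" using B by blast
  moreover have "f y \<notin> ?S" using B y by blast
  ultimately have eq: "f ` B = f ` B'"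
    using sym_diff_subset_circuit[of "f ` B" "f ` B'" "f ` C"] image_circuit B C y by blast
  have "B \<union> B' = C \<union> D" using M.ear_circuits_Un[OF E] B by blast
  then have "f ` B = f ` C \<union> f ` D" using eq by (metis image_Un sup.idem)
  then have "f ` C = f ` B" using N.circuits_antichain[OF C] image_circuit B(1) by blast
  then show ?thesis using \<open>f ` B = f ` C \<union> f ` D\<close> by (metis sup_ge2)
qed

text \<open>Here the images of the two circuits through the ear must differ, so their symmetric
  difference is the whole image of \<open>C\<close>; this leaves no overlap between the images of
  the two parts.\<close>

lemma ear_splits_circuit:
  assumes E: "M.is_ear C D" and disj: "f ` (D - C) \<inter> f ` C = {}"
  obtains A A' where "A \<union> A' = C" "D - C \<union> A \<in> circuits M" "D - C \<union> A' \<in> circuits M"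
    "f ` A \<inter> f ` A' = {}"
proof -
  obtain B B' where B: "B \<in> circuits M" "B' \<in> circuits M" "B \<noteq> B'"
    "B \<subseteq> C \<union> D" "B' \<subseteq> C \<union> D" "D - C \<subseteq> B" "D - C \<subseteq> B'"
    using M.ear_two_circuits[OF E] by metis
  have C: "C \<in> circuits M" "f ` C \<in> circuits N"
    using E image_circuit unfolding M.is_ear_def by blast+
  let ?A = "B \<inter> C" and ?A' = "B' \<inter> C"
  have U: "?A \<union> ?A' = C" using M.ear_circuits_Un[OF E] B by blast
  have split: "B = D - C \<union> ?A" "B' = D - C \<union> ?A'" using B by blast+
  obtain s where s: "s \<in> D - C"
    using E M.circuits_antichain[of D C] unfolding M.is_ear_def by blast
  have ne: "f ` B \<noteq> f ` B'"
  proof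
    assume "f ` B = f ` B'"
    then have "f ` C \<subseteq> f ` B" using U by blast
    then have "f ` C = f ` B" using N.circuits_antichain[OF C(2)] image_circuit B(1) by blast
    then show False using s B disj by blast
  qed
  have im: "f ` B = f ` (D - C) \<union> f ` ?A" "f ` B' = f ` (D - C) \<union> f ` ?A'"
    using split by (metis image_Un)+
  have sub: "f ` ?A \<subseteq> f ` C" "f ` ?A' \<subseteq> f ` C" by blast+
  have "(f ` B - f ` B') \<union> (f ` B' - f ` B) = f ` C"
    using ne sym_diff_subset_circuit[of "f ` B" "f ` B'" "f ` C"] image_circuit B C im sub by blast
  then have "f ` ?A \<inter> f ` ?A' = {}" using im sub by blast
  then show thesis using that U split B by metis
qed

text \<open>Both circuits are cut by \<open>S\<close> into parts whose images partition
  \<open>F\<close>. Binarity makes the two partitions equal, and a part is determined by its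
  image.\<close>

lemma common_ear_unique:
  assumes E: "M.is_ear C D" "M.is_ear C' D'" and S: "D - C = S" "D' - C' = S"
    and F: "f ` C = F" "f ` C' = F" and disj: "f ` S \<inter> F = {}"
    and ear: "\<And>B. B \<in> circuits M \<Longrightarrow> B \<subseteq> C \<union> C' \<union> S \<Longrightarrow> B \<subseteq> C \<union> C' \<or> S \<subseteq> B"
    and SCC: "S \<inter> (C \<union> C') = {}"
  shows "C = C'"
proof -
  obtain A1 A2 where A: "A1 \<union> A2 = C" "S \<union> A1 \<in> circuits M" "S \<union> A2 \<in> circuits M"
    "f ` A1 \<inter> f ` A2 = {}"
    using ear_splits_circuit[OF E(1)] S F disj by metis
  obtain B1 B2 where B: "B1 \<union> B2 = C'" "S \<union> B1 \<in> circuits M" "S \<union> B2 \<in> circuits M"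
    "f ` B1 \<inter> f ` B2 = {}"
    using ear_splits_circuit[OF E(2)] S F disj by metis
  have FN: "F \<in> circuits N" using E(1) F image_circuit unfolding M.is_ear_def by blast
  obtain s where s: "s \<in> S"
    using E(1) M.circuits_antichain[of D C] S(1) unfolding M.is_ear_def by blast
  have AF: "f ` A1 \<union> f ` A2 = F" and BF: "f ` B1 \<union> f ` B2 = F"
    using A B F by (metis image_Un)+
  \<comment> \<open>Eliminating \<open>s\<close> from distinct circuits would give a circuit
    avoiding \<open>S\<close> whose image lies both in \<open>F\<close> and in the image of
    \<open>S \<union> P\<close>. The antichain property would identify these, yet \<open>f s\<close>
    is outside \<open>F\<close>.\<close>
  have same: "P = Q"
    if P: "S \<union> P \<in> circuits M" "P \<subseteq> C" and Q: "S \<union> Q \<in> circuits M" "Q \<subseteq> C'"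
      and eq: "f ` P = f ` Q" for P Q
  proof (rule ccontr)
    assume "P \<noteq> Q"
    then have "S \<union> P \<noteq> S \<union> Q" using SCC P Q by blast
    then obtain G where G: "G \<in> circuits M" "G \<subseteq> S \<union> P \<union> (S \<union> Q) - {s}"
      using M.circuit_elimination[of "S \<union> P" "S \<union> Q" s] P Q s by blast
    then have "G \<subseteq> C \<union> C'" using ear[of G] P Q s by blast
    then have "G \<subseteq> P \<union> Q" using G SCC by blast
    then have "f ` G \<subseteq> f ` P" using eq by (metis image_Un image_mono sup.idem)
    moreover have "f ` P \<subseteq> F" "f ` P \<subseteq> f ` (S \<union> P)"
      using P(2) F(1) by (metis image_mono, simp add: image_Un)
    ultimately have "f ` G \<subseteq> f ` (S \<union> P)" "f ` G \<subseteq> F" by (metis subset_trans)+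
    then have "f ` (S \<union> P) = F"
      using N.circuits_antichain image_circuit G P FN by metis
    then show False using s disj by blast
  qed
  have compl: "Q = Q'" if "P \<union> Q = F" "P \<union> Q' = F" "P \<inter> Q = {}" "P \<inter> Q' = {}" for P Q Q'
    using that by blast
  have diff: "f ` (S \<union> P) - f ` (S \<union> Q) = f ` P - f ` Q" if "f ` P \<subseteq> F" for P Q
    using that disj by (simp only: image_Un) blast
  have sub: "f ` A1 \<subseteq> F" "f ` B1 \<subseteq> F" using AF BF by blast+
  \<comment> \<open>If the images of \<open>A1\<close> and \<open>B1\<close> differ, that of
    \<open>S\<close> cancels in the symmetric difference, which is then \<open>F\<close>; so
    \<open>B1\<close> maps onto the complement in \<open>F\<close> of the image of
    \<open>A1\<close>.\<close>
  have "f ` B1 = f ` A1 \<or> f ` B1 = f ` A2"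
  proof (cases "f ` A1 = f ` B1")
    case False
    then have "f ` (S \<union> A1) \<noteq> f ` (S \<union> B1)" using diff sub by blast
    moreover have "f ` (S \<union> A1) \<in> circuits N" "f ` (S \<union> B1) \<in> circuits N"
      using image_circuit A(2) B(2) by blast+
    moreover have "(f ` A1 - f ` B1) \<union> (f ` B1 - f ` A1) \<subseteq> F" using sub by blast
    ultimately have "(f ` A1 - f ` B1) \<union> (f ` B1 - f ` A1) = F"
      using sym_diff_subset_circuit[of "f ` (S \<union> A1)" "f ` (S \<union> B1)" F] FN
      unfolding diff[OF sub(1)] diff[OF sub(2)] by blast
    then have "f ` A1 \<union> f ` B1 = F" "f ` A1 \<inter> f ` B1 = {}" using sub by auto
    then show ?thesis using compl AF A(4) by metis
  qed simp
  then show ?thesis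
  proof
    assume "f ` B1 = f ` A1"
    moreover then have "f ` B2 = f ` A2" using compl AF BF A(4) B(4) by metis
    ultimately have "A1 = B1" "A2 = B2" using same[of A1 B1] same[of A2 B2] A B by auto
    then show ?thesis using A B by blast
  next
    assume "f ` B1 = f ` A2"
    moreover then have "f ` B2 = f ` A1" using compl AF BF A(4) B(4) by (metis Int_commute Un_commute)
    ultimately have "A2 = B1" "A1 = B2" using same[of A2 B1] same[of A1 B2] A B by auto
    then show ?thesis using A B by blast
  qed
qed

text \<open>Otherwise an ear on \<open>C \<union> D\<close> reaching an element mapped outside the
  image of \<open>C\<close> would be an ear of two distinct circuits, against
  \<open>common_ear_unique\<close>.\<close>

lemma collapsed_ear_image:
  assumes conn: "connected_matroid M" and E: "M.is_ear C D" and sub: "f ` D \<subseteq> f ` C"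
  shows "f ` ground M = f ` C"
proof (rule ccontr)
  assume ne: "f ` ground M \<noteq> f ` C"
  let ?F = "f ` C" and ?X = "C \<union> D"
  have C: "C \<in> circuits M" "D \<in> circuits M" using E unfolding M.is_ear_def by blast+
  obtain y where y: "y \<in> ground M" "f y \<notin> ?F"
    using ne M.circuits_subset[OF C(1)] by blast
  then have yX: "y \<notin> ?X" using sub by blast
  obtain x where x: "x \<in> C" using E unfolding M.is_ear_def by blast
  then obtain K where K: "K \<in> circuits M" "y \<in> K" "x \<in> K"
    using circuit_through[OF conn C(1)] y(1) yX by (metis UnCI)
  have "K \<inter> ?X \<noteq> {}" using K x by blast
  then obtain L where L: "L \<in> circuits M" "y \<in> L" "L \<inter> ?X \<noteq> {}"
    and ear: "\<And>B. B \<in> circuits M \<Longrightarrow> B \<subseteq> ?X \<union> L \<Longrightarrow> B \<subseteq> ?X \<or> L - ?X \<subseteq> B"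
    using M.minimal_ear[OF K(1,2) yX, of UNIV] by auto
  let ?S = "L - ?X"
  \<comment> \<open>An attachment point of the new ear: every circuit through \<open>z\<close> meets
    \<open>L\<close>, and two of them lie in \<open>?X\<close>.\<close>
  obtain z where z: "z \<in> L" "z \<in> ?X" using L by blast
  obtain G G' where G: "G \<in> circuits M" "G' \<in> circuits M" "G \<noteq> G'"
    "G \<subseteq> ?X" "G' \<subseteq> ?X" "z \<in> G" "z \<in> G'"
    using M.ear_two_circuits_through[OF E z(2)] by metis
  have FX: "f ` ?X = ?F" using sub by blast
  have ear_on: "\<exists>Q. M.is_ear P Q \<and> Q - P = ?S \<and> f ` P = ?F \<and> f ` ?S \<inter> ?F = {}"
    if P: "P \<in> circuits M" "P \<subseteq> ?X" "z \<in> P" for P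
  proof -
    have "f ` P \<subseteq> ?F" using P FX by blast
    then have PF: "f ` P = ?F" using N.circuits_antichain[of "f ` P" ?F] image_circuit P(1) C(1) by blast
    have "P \<inter> L \<noteq> {}" "P \<union> L \<subseteq> ?X \<union> L" "y \<notin> P" using P z yX by blast+
    then obtain Q where Q: "M.is_ear P Q" "y \<in> Q" "Q \<subseteq> ?X \<union> L"
      using M.ear_exists[of P L y "?X \<union> L"] P L by blast
    \<comment> \<open>One element of \<open>Q - P\<close> mapped into \<open>?F\<close> would pull
      the image of all of \<open>Q\<close>, including \<open>f y\<close>, into \<open>?F\<close>.
      Since \<open>?X\<close> maps into \<open>?F\<close>, the ear is thereby kept off
      \<open>?X\<close>.\<close>
    have out: "f ` (Q - P) \<inter> ?F = {}"
      using ear_image_subset[OF Q(1)] PF Q(2) y(2) by blast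
    then have "(Q - P) \<inter> ?X = {}" using FX by blast
    then have "Q - P \<subseteq> ?S" using Q by blast
    moreover have "?S \<subseteq> Q" using ear[of Q] Q yX unfolding M.is_ear_def by blast
    ultimately have "Q - P = ?S" using P by blast
    then show ?thesis using Q PF out by auto
  qed
  obtain Q where Q: "M.is_ear G Q" "Q - G = ?S" "f ` G = ?F" "f ` ?S \<inter> ?F = {}"
    using ear_on[of G] G by blast
  obtain Q' where Q': "M.is_ear G' Q'" "Q' - G' = ?S" "f ` G' = ?F"
    using ear_on[of G'] G by blast
  have "B \<subseteq> G \<union> G' \<or> ?S \<subseteq> B" if "B \<in> circuits M" "B \<subseteq> G \<union> G' \<union> ?S" for B
    using ear[of B] that G by blast
  moreover have "?S \<inter> (G \<union> G') = {}" using G by blast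
  ultimately have "G = G'"
    using common_ear_unique[OF Q(1) Q'(1) Q(2) Q'(2) Q(3) Q'(3) Q(4)] by blast
  then show False using G by blast
qed

end

text \<open>This condition makes the image of \<open>M\<close> a matroid and \<open>g\<close> a
  homeomorphism onto it. The map is arbitrary because the relabellings that build the subdivision
  must satisfy it too.\<close>

definition circuit_saturated :: "'a set_system \<Rightarrow> ('a \<Rightarrow> 'b) \<Rightarrow> bool" where
  "circuit_saturated M g \<longleftrightarrow>
    (\<forall>C \<in> circuits M. \<forall>x \<in> C. \<forall>y \<in> ground M. g x = g y \<longrightarrow> y \<in> C)"

lemma circuit_saturatedD:
  assumes "circuit_saturated M g" "C \<in> circuits M" "y \<in> ground M" "g y \<in> g ` C"
  shows "y \<in> C"
  using assms unfolding circuit_saturated_def by (metis imageE)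

text \<open>A missing fibre element \<open>y\<close> would give an ear on \<open>C\<close> that
  collapses, making the image of \<open>C\<close> the whole ground set of \<open>N\<close>.\<close>

lemma (in binary_matroid_hom) hom_circuit_saturated:
  assumes conn: "connected_matroid M" and N: "ground N \<notin> circuits N"
  shows "circuit_saturated M f"
  unfolding circuit_saturated_def
proof (intro ballI impI, rule ccontr)
  fix C x y assume C: "C \<in> circuits M" "x \<in> C" and y: "y \<in> ground M" "f x = f y" "y \<notin> C"
  obtain K where "K \<in> circuits M" "y \<in> K" "x \<in> K"
    using circuit_through[OF conn C] y by metis
  then obtain D where D: "M.is_ear C D" "y \<in> D"
    using M.ear_exists[of C K y UNIV] C y by blast
  have "y \<in> D - C" "f y \<in> f ` C" using D y C by (blast, metis imageI)
  then have "f ` ground M = f ` C"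
    using ear_image_subset[OF D(1)] collapsed_ear_image[OF conn D(1)] by blast
  then show False using N hom image_circuit C unfolding matroid_hom_def by metis
qed

section \<open>Saturated images and subdivisions\<close>

lemma image_system_sel [simp]:
  "ground (image_system g M) = g ` ground M"
  "circuits (image_system g M) = (\<lambda>C. g ` C) ` circuits M"
  unfolding image_system_def by simp_all

context matroid
begin

lemma saturated_image_subset:
  assumes "circuit_saturated M g" "C \<in> circuits M" "D \<in> circuits M" "g ` C \<subseteq> g ` D"
  shows "C \<subseteq> D"
  using circuit_saturatedD[OF assms(1,3)] circuits_subset[OF assms(2)] assms(4) by blast

lemma saturated_vimage:
  assumes "circuit_saturated M g" "C \<in> circuits M"
  shows "g -` (g ` C) \<inter> ground M = C"
  using circuit_saturatedD[OF assms] circuits_subset[OF assms(2)] by blast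

text \<open>Images of circuits are included in each other only if the circuits are. For elimination,
  a preimage \<open>x\<close> of \<open>e\<close> lies in both circuits by saturation, and a circuit
  avoiding \<open>x\<close> has an image avoiding \<open>e\<close>.\<close>

lemma matroid_saturated_image:
  assumes sat: "circuit_saturated M g"
  shows "matroid (image_system g M)"
proof
  show "finite (ground (image_system g M))" using finite_ground by simp
  show "C \<subseteq> ground (image_system g M)" if "C \<in> circuits (image_system g M)" for C
    using that circuits_subset by fastforce
  show "{} \<notin> circuits (image_system g M)" using empty_not_circuit by auto
  show "C = D"
    if CD: "C \<in> circuits (image_system g M)" "D \<in> circuits (image_system g M)" "C \<subseteq> D" for C D
  proof -
    obtain C' D' where "C' \<in> circuits M" "C = g ` C'" "D' \<in> circuits M" "D = g ` D'"
      using CD(1,2) by auto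
    then show ?thesis
      using CD(3) saturated_image_subset[OF sat, of C' D'] circuits_antichain[of C' D'] by simp
  qed
  fix C D e
  assume CD: "C \<in> circuits (image_system g M)" "D \<in> circuits (image_system g M)" "C \<noteq> D"
    and e: "e \<in> C \<inter> D"
  from CD obtain C' D' where C': "C' \<in> circuits M" "C = g ` C'" and D': "D' \<in> circuits M" "D = g ` D'"
    by auto
  from e C' obtain x where x: "x \<in> C'" "e = g x" by blast
  have xM: "x \<in> ground M" using x C' circuits_subset by blast
  have "g x \<in> g ` D'" using e D'(2) x(2) by simp
  then have xD: "x \<in> D'" by (rule circuit_saturatedD[OF sat D'(1) xM])
  have "C' \<noteq> D'" using CD(3) C'(2) D'(2) by auto
  then obtain B where B: "B \<in> circuits M" "B \<subseteq> C' \<union> D' - {x}"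
    using circuit_elimination[OF C'(1) D'(1)] x(1) xD by auto
  have "e \<notin> g ` B" using circuit_saturatedD[OF sat B(1) xM] B(2) x(2) by auto
  moreover have "g ` B \<subseteq> g ` (C' \<union> D')" using B(2) by blast
  ultimately have "g ` B \<subseteq> C \<union> D - {e}" unfolding C'(2) D'(2) by (simp add: image_Un subset_Diff_insert)
  then show "\<exists>B\<in>circuits (image_system g M). B \<subseteq> C \<union> D - {e}" using B(1) by auto
qed

text \<open>Elements of one fibre lie in the same circuits. Starting from one representative per
  fibre, the others are added one at a time, each by a series extension at the label of its
  fibre.\<close>

lemma saturated_isomorphic_to_subdivision:
  assumes sat: "circuit_saturated M g"
  shows "isomorphic_to_subdivision M (image_system g M)"
proof -
  obtain R where R: "R \<subseteq> ground M" "inj_on g R" "g ` R = g ` ground M"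
    by (metis subset_image_inj subset_refl)
  obtain k :: "'a \<Rightarrow> nat" where k: "inj_on k (ground M)"
    using finite_ground finite_imp_inj_to_nat_seg by blast
  \<comment> \<open>Elements of \<open>Q\<close> have received fresh labels, the others still carry
    their fibre's label. Thus \<open>Q = {}\<close> gives the copy of the image, and
    \<open>Q = ground M - R\<close> an injective relabelling of \<open>M\<close>.\<close>
  define \<psi> where "\<psi> Q x = (if x \<in> Q then Inr (k x) else Inl (g x))" for Q x
  have \<psi>_sat: "circuit_saturated M (\<psi> Q)" if "Q \<subseteq> ground M" for Q
    using sat k that circuits_subset unfolding circuit_saturated_def \<psi>_def
    by (auto split: if_splits dest: inj_onD)
  have series: "series_extension (image_system (\<psi> Q) M) (Inl (g x)) (Inr (k x))
      (image_system (\<psi> (insert x Q)) M)"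
    if x: "x \<in> ground M" "x \<notin> R" "x \<notin> Q" and Q: "Q \<subseteq> ground M" "Q \<inter> R = {}" for x Q
  proof -
    obtain r where r: "r \<in> R" "g r = g x" using R x by (metis imageE imageI)
    have r': "r \<in> ground M" "r \<notin> Q" "r \<noteq> x" using r R x Q by blast+
    have new: "\<psi> (insert x Q) ` A = \<psi> Q ` A" if "x \<notin> A" for A
      using that unfolding \<psi>_def by (intro image_cong) auto
    \<comment> \<open>The representative \<open>r\<close> stays outside \<open>Q\<close>, so the
      fibre's label survives when \<open>x\<close> is relabelled.\<close>
    have add: "\<psi> (insert x Q) ` A = \<psi> Q ` A \<union> {Inr (k x)}" if A: "x \<in> A" "r \<in> A" for A
    proof -
      have "\<psi> (insert x Q) ` A = \<psi> Q ` (A - {x}) \<union> {Inr (k x)}"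
        using A new[of "A - {x}"] by (metis Diff_iff Un_insert_right \<psi>_def image_insert
          insertI1 insert_Diff sup_bot_right)
      moreover have "\<psi> Q x = \<psi> Q r" using r r' x unfolding \<psi>_def by simp
      then have "\<psi> Q ` (A - {x}) = \<psi> Q ` A" using A r' by (auto simp: image_iff)
      ultimately show ?thesis by simp
    qed
    have xr: "x \<in> C \<longleftrightarrow> r \<in> C" if "C \<in> circuits M" for C
      using sat that r(2) r'(1) x(1) unfolding circuit_saturated_def by metis
    have mem: "Inl (g x) \<in> \<psi> Q ` C \<longleftrightarrow> x \<in> C" if C: "C \<in> circuits M" for C
    proof
      assume "Inl (g x) \<in> \<psi> Q ` C"
      then obtain c where "c \<in> C" "g c = g x" unfolding \<psi>_def by (auto split: if_splits)
      then show "x \<in> C" using sat C x(1) unfolding circuit_saturated_def by blast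
    next
      assume "x \<in> C"
      then show "Inl (g x) \<in> \<psi> Q ` C" using x(3) unfolding \<psi>_def by force
    qed
    have "circuits (image_system (\<psi> (insert x Q)) M) =
      {C. C \<in> circuits (image_system (\<psi> Q) M) \<and> Inl (g x) \<notin> C} \<union>
      {C \<union> {Inr (k x)} | C. C \<in> circuits (image_system (\<psi> Q) M) \<and> Inl (g x) \<in> C}" (is "?L = ?P \<union> ?Q")
    proof (intro subset_antisym subsetI)
      fix B assume "B \<in> ?L"
      then obtain C where C: "C \<in> circuits M" "B = \<psi> (insert x Q) ` C" by auto
      show "B \<in> ?P \<union> ?Q"
      proof (cases "x \<in> C")
        case True
        then have "B = \<psi> Q ` C \<union> {Inr (k x)}" using add xr C by blast
        then show ?thesis using C mem True by auto
      next
        case False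
        then show ?thesis using C mem new by auto
      qed
    next
      fix B assume "B \<in> ?P \<union> ?Q"
      then show "B \<in> ?L"
      proof
        assume "B \<in> ?P"
        then obtain C where C: "C \<in> circuits M" "B = \<psi> Q ` C" "Inl (g x) \<notin> \<psi> Q ` C" by auto
        then have "B = \<psi> (insert x Q) ` C" using mem new by simp
        then show ?thesis using C by simp
      next
        assume "B \<in> ?Q"
        then obtain C where C: "C \<in> circuits M" "B = \<psi> Q ` C \<union> {Inr (k x)}" "Inl (g x) \<in> \<psi> Q ` C"
          unfolding image_system_sel by blast
        then have "x \<in> C" "r \<in> C" using mem xr by blast+
        then have "B = \<psi> (insert x Q) ` C" using add C by simp
        then show ?thesis using C by simp
      qed
    qed
    moreover have "Inr (k x) \<notin> \<psi> Q ` ground M"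
      using k x Q unfolding \<psi>_def by (auto split: if_splits dest: inj_onD)
    moreover have "Inl (g x) \<in> \<psi> Q ` ground M" using x unfolding \<psi>_def by force
    moreover have "insert x Q \<subseteq> ground M" using x Q by blast
    ultimately show ?thesis
      unfolding series_extension_def
      using matroid_saturated_image[OF \<psi>_sat] Q add[OF x(1) r'(1)] by simp
  qed
  have sub: "subdivision (image_system Inl (image_system g M)) (image_system (\<psi> Q) M)"
    if "finite Q" "Q \<subseteq> ground M - R" for Q
    using that
  proof (induction Q rule: finite_induct)
    case empty
    have "image_system (\<psi> {}) M = image_system Inl (image_system g M)"
      unfolding image_system_def \<psi>_def by (auto simp: image_image)
    then show ?case
      using subdivision.refl matroid_saturated_image[OF \<psi>_sat, of "{}"] by simp
  next
    case (insert x Q)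
    have "series_extension (image_system (\<psi> Q) M) (Inl (g x)) (Inr (k x))
      (image_system (\<psi> (insert x Q)) M)"
      by (rule series) (use insert in auto)
    moreover have "subdivision (image_system Inl (image_system g M)) (image_system (\<psi> Q) M)"
      using insert by simp
    ultimately show ?case by (rule subdivision.step[rotated])
  qed
  let ?Q = "ground M - R"
  have inj: "inj_on (\<psi> ?Q) (ground M)"
    using k R(2) unfolding \<psi>_def inj_on_def by auto
  have "isomorphic_matroids M (image_system (\<psi> ?Q) M)"
    unfolding isomorphic_matroids_def
  proof (intro exI conjI allI impI)
    show "bij_betw (\<psi> ?Q) (ground M) (ground (image_system (\<psi> ?Q) M))"
      using inj unfolding bij_betw_def by simp
    show "C \<in> circuits M \<longleftrightarrow> \<psi> ?Q ` C \<in> circuits (image_system (\<psi> ?Q) M)" if "C \<subseteq> ground M" for C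
      using that inj circuits_subset inj_on_image_eq_iff by fastforce
  qed
  then show ?thesis
    unfolding isomorphic_to_subdivision_def using sub[of ?Q] finite_ground by blast
qed

end

theorem theorem3:
  fixes M :: "'a set_system" and N :: "'b set_system" and f :: "'a \<Rightarrow> 'b"
  assumes "matroid M" and "connected_matroid M"
    and "matroid N" and "binary_matroid N" and "ground N \<notin> circuits N"
    and "matroid_hom M N f"
  shows "\<exists>(H :: 'b set_system) (g :: 'a \<Rightarrow> 'b) (h :: 'b \<Rightarrow> 'b).
    matroid H \<and> matroid_homeo M H g \<and> circuit_injection H N h \<and>
    (\<forall>x \<in> ground M. f x = (h \<circ> g) x) \<and>
    H = image_system g M \<and> isomorphic_to_subdivision M H"
proof -
  interpret binary_matroid_hom M N f
    using assms unfolding binary_matroid_hom_def binary_matroid_hom_axioms_def by blast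
  \<comment> \<open>The image has the ground set of \<open>N\<close> and some of its circuits, so
    \<open>f\<close> serves as \<open>g\<close> and the identity as \<open>h\<close>.\<close>
  let ?H = "image_system f M"
  have sat: "circuit_saturated M f" using hom_circuit_saturated assms by blast
  have "matroid_homeo M ?H f"
    unfolding matroid_homeo_def matroid_hom_def using M.saturated_vimage[OF sat] by auto
  moreover have "circuit_injection ?H N id"
    using hom unfolding circuit_injection_def matroid_hom_def by auto
  ultimately show ?thesis
    using M.matroid_saturated_image[OF sat] M.saturated_isomorphic_to_subdivision[OF sat]
    by (intro exI[of _ ?H] exI[of _ f] exI[of _ id]) simp
qed

end
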